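(* Let $G$ be a finite group, $\mathbb F$ a field with $\mathrm{char}(\mathbb F)\nmid|G|$, and $V=V_1\oplus\dots\oplus V_r$ a finite dimensional $G$-module over $\mathbb F$ decomposed into a direct sum of $G$-modules. For every $k\in\mathbb N$ we have $\mathsf D_k(\mathcal B(G,V))\le\beta_k(G,V)$.
   Context: $\mathbb F[V]=\mathrm{Sym}(V^* )$ carries the induced $G$-action by $\mathbb F$-algebra automorphisms and the $\mathbb N_0^r$-grading $\mathbb F[V]=\bigoplus_{a\in\mathbb N_0^r}\mathbb F[V]_a$ with $\mathbb F[V]_a=\mathrm{Sym}^{a_1}(V_1^* )\otimes\dots\otimes\mathrm{Sym}^{a_r}(V_r^* )$. $\mathbb F[V]^G$ is the ring of invariants, $\mathbb F[V]^G_a=\mathbb F[V]^G\cap\mathbb F[V]_a$, and $\mathcal B(G,V)=\{a\in\mathbb N_0^r\colon\mathbb F[V]^G_a\ne\{0\}\}$, a submonoid of $(\mathbb N_0^r,+)$. Its degree function is $|a|=a_1+\dots+a_r$. For $a\in\mathcal B(G,V)$, $\mathsf L(a)$ is the set of all $l$ such that $a$ is a sum of $l$ atoms (irreducible elements) of $\mathcal B(G,V)$ ($\mathsf L(0)=\{0\}$), and $\mathsf D_k(\mathcal B(G,V))=\sup\{|a|\colon a\in\mathcal B(G,V),\ \max\mathsf L(a)\le k\}$. $\beta_k(G,V)$ is the top degree (with respect to the standard grading) of the factor space $\mathbb F[V]^G_+/(\mathbb F[V]^G_+)^{k+1}$, where $\mathbb F[V]^G_+$ is the ideal of $\mathbb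 F[V]^G$ spanned by homogeneous invariants of positive degree. *)

theory Defs
  imports
    "HOL-Algebra.Group_Action"
    "HOL-Algebra.Ideal_Product"
    "HOL-Algebra.Divisibility"
    "HOL-Library.Poly_Mapping"
    "HOL-Library.Extended_Nat"
begin

text \<open>The polynomial algebra over \<open>'f\<close> with indeterminates in \<open>'x\<close>: finitely supported
  coefficient functions on the monoid of finitely supported exponent functions.\<close>

type_synonym ('x, 'f) mpoly = "('x \<Rightarrow>\<^sub>0 nat) \<Rightarrow>\<^sub>0 'f"

definition Const :: "'f::field \<Rightarrow> ('x, 'f) mpoly" where
  "Const c = Poly_Mapping.single 0 c"

definition Var :: "'x \<Rightarrow> ('x, 'f::field) mpoly" where
  "Var x = Poly_Mapping.single (Poly_Mapping.single x 1) 1"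

definition subst :: "('x \<Rightarrow> ('y, 'f::field) mpoly) \<Rightarrow> ('x, 'f) mpoly \<Rightarrow> ('y, 'f) mpoly" where
  "subst \<sigma> p = (\<Sum>m\<in>Poly_Mapping.keys p. Const (Poly_Mapping.lookup p m) *
      (\<Prod>x\<in>Poly_Mapping.keys m. \<sigma> x ^ Poly_Mapping.lookup m x))"


text \<open>The vector space \<open>V\<close> is the whole type \<open>'v\<close> with scalar multiplication \<open>scale\<close>;
  \<open>W 1, \<dots>, W r\<close> are its direct summands \<open>V\<^sub>1, \<dots>, V\<^sub>r\<close>, and values of \<open>W\<close> outside \<open>{1..r}\<close>
  play no role. Note that \<open>group_action\<close> includes that \<open>G\<close> is a group.\<close>

locale decomposed_G_module =
  vector_space scale + group_action G "UNIV :: 'v set" \<rho>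
  for scale :: "'f::field \<Rightarrow> 'v::ab_group_add \<Rightarrow> 'v"
    and G :: "'g monoid" (structure)
    and \<rho> :: "'g \<Rightarrow> 'v \<Rightarrow> 'v"
    and r :: nat
    and W :: "nat \<Rightarrow> 'v set" +
  assumes finite_group: "finite (carrier G)"
    and finite_dimensional: "\<exists>S. finite S \<and> span S = UNIV"
    and linear_action: "g \<in> carrier G \<Longrightarrow> Vector_Spaces.linear scale scale (\<rho> g)"
    and summand_subspace: "i \<in> {1..r} \<Longrightarrow> subspace (W i)"
    and summand_stable: "i \<in> {1..r} \<Longrightarrow> g \<in> carrier G \<Longrightarrow> v \<in> W i \<Longrightarrow> \<rho> g v \<in> W i"
    and direct_sum: "\<exists>!w. w \<in> (\<Pi>\<^sub>E i\<in>{1..r}. W i) \<and> v = (\<Sum>i\<in>{1..r}. w i)"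


text \<open>A choice of bases \<open>X i\<close> of the summands identifies \<open>Sym(V\<^sup>*)\<close> with the polynomial algebra in
  the dual coordinates: the indeterminate \<open>Var b\<close> is the linear form that takes the value 1
  at the basis vector \<open>b\<close> and 0 at all other basis vectors.\<close>

locale decomposed_G_module_with_basis =
  decomposed_G_module scale G \<rho> r W
  for scale :: "'f::field \<Rightarrow> 'v::ab_group_add \<Rightarrow> 'v"
    and G :: "'g monoid" (structure)
    and \<rho> :: "'g \<Rightarrow> 'v \<Rightarrow> 'v"
    and r :: nat
    and W :: "nat \<Rightarrow> 'v set"
    and X :: "nat \<Rightarrow> 'v set" +
  assumes basis: "i \<in> {1..r} \<Longrightarrow> independent (X i) \<and> span (X i) = W i"
begin

definition B :: "'v set" where
  "B = (\<Union>i\<in>{1..r}. X i)"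

definition FV :: "('v, 'f) mpoly set" where
  "FV = {p. \<forall>m\<in>Poly_Mapping.keys p. Poly_Mapping.keys m \<subseteq> B}"

definition linear_form :: "('v \<Rightarrow> 'f) \<Rightarrow> ('v, 'f) mpoly" where
  "linear_form \<xi> = (\<Sum>b\<in>B. Const (\<xi> b) * Var b)"

text \<open>The algebra endomorphism extending the dual action \<open>(g \<cdot> \<xi>)(v) = \<xi>(g\<^sup>-\<^sup>1 v)\<close> on \<open>V\<^sup>*\<close>;
  here \<open>\<lambda>v. representation B v b\<close> is the coordinate function of \<open>b\<close>.\<close>

definition act :: "'g \<Rightarrow> ('v, 'f) mpoly \<Rightarrow> ('v, 'f) mpoly" where
  "act g = subst (\<lambda>b. linear_form (\<lambda>v. representation B (\<rho> (inv g) v) b))"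

definition FV_multi :: "(nat \<Rightarrow> nat) \<Rightarrow> ('v, 'f) mpoly set" where
  "FV_multi a = {p \<in> FV. \<forall>m\<in>Poly_Mapping.keys p. \<forall>i\<in>{1..r}.
      (\<Sum>b\<in>X i. Poly_Mapping.lookup m b) = a i}"

definition FV_deg :: "nat \<Rightarrow> ('v, 'f) mpoly set" where
  "FV_deg d = {p \<in> FV. \<forall>m\<in>Poly_Mapping.keys p. (\<Sum>b\<in>B. Poly_Mapping.lookup m b) = d}"

definition Inv :: "('v, 'f) mpoly set" where
  "Inv = {p \<in> FV. \<forall>g\<in>carrier G. act g p = p}"

definition Inv_ring :: "('v, 'f) mpoly ring" where
  "Inv_ring = \<lparr>carrier = Inv, monoid.mult = (*), one = 1, zero = 0, add = (+)\<rparr>"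

definition Inv_plus :: "('v, 'f) mpoly set" where
  "Inv_plus = Idl\<^bsub>Inv_ring\<^esub> (\<Union>d\<in>{1..}. Inv \<inter> FV_deg d)"

text \<open>The monoid \<open>\<B>(G,V)\<close> as an additive monoid in the (multiplicatively written) record
  format of \<open>HOL-Algebra\<close>. Elements of \<open>\<nat>\<^sub>0\<^sup>r\<close> are functions vanishing outside \<open>{1..r}\<close>.\<close>

definition BGV :: "(nat \<Rightarrow> nat) monoid" where
  "BGV = \<lparr>carrier = {a. (\<forall>i. i \<notin> {1..r} \<longrightarrow> a i = 0) \<and> Inv \<inter> FV_multi a \<noteq> {0}},
          monoid.mult = (\<lambda>a b i. a i + b i), one = (\<lambda>_. 0)\<rparr>"

definition lengths :: "(nat \<Rightarrow> nat) \<Rightarrow> nat set" where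
  "lengths a = {length as |as. set as \<subseteq> carrier BGV \<and> factors BGV as a}"

definition D :: "nat \<Rightarrow> enat" where
  "D k = (SUP a \<in> {a \<in> carrier BGV. Max (lengths a) \<le> k}. enat (\<Sum>i\<in>{1..r}. a i))"

text \<open>For graded submodules \<open>N \<subseteq> M\<close>, the degree \<open>d\<close> component of \<open>M/N\<close> is nonzero iff some
  homogeneous element of \<open>M\<close> of degree \<open>d\<close> lies outside \<open>N\<close>. The top degree of the zero space
  is 0.\<close>

definition beta :: "nat \<Rightarrow> enat" where
  "beta k = (SUP d \<in> {d. \<exists>f \<in> Inv_plus \<inter> FV_deg d.
      f \<notin> Inv_plus [^]\<^bsub>ideals_set Inv_ring\<^esub> (k + 1)}. enat d)"

end

end

theory Submission
  imports Defs
begin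

text \<open>
  The multidegree of a product of multihomogeneous invariants is the sum of their multidegrees in
  \<open>\<B>(G,V)\<close>, so an invariant in a high power of \<open>F[V]\<^sup>G\<^sub>+\<close> has multidegrees with long
  factorizations. Concretely, let \<open>deep_Inv l\<close> consist of the invariants all of whose monomials have
  a multidegree that is a sum of at least \<open>l\<close> atoms. The proof compares this filtration with the
  powers of \<open>F[V]\<^sup>G\<^sub>+\<close>.

  Each summand \<open>V\<^sub>i\<close> is \<open>G\<close>-stable, hence the action on polynomials preserves multidegrees
  (\<open>keys_act\<close>). Therefore every multihomogeneous component of an invariant is again an invariant, and
  the multidegree of every monomial that occurs in an invariant belongs to \<open>\<B>(G,V)\<close>
  (\<open>multideg_in_BGV\<close>). A nonzero element of \<open>\<B>(G,V)\<close> is a sum of at least one atom, so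
  \<open>F[V]\<^sup>G\<^sub>+ \<subseteq> deep_Inv 1\<close>. Factorizations of two multidegrees concatenate, so \<open>deep_Inv l\<close> times
  \<open>deep_Inv l'\<close> lies in \<open>deep_Inv (l + l')\<close>. It follows that the \<open>n\<close>-th power of \<open>F[V]\<^sup>G\<^sub>+\<close> is
  contained in \<open>deep_Inv n\<close> (\<open>Inv_plus_power_subset_deep\<close>).

  Now let \<open>a \<noteq> 0\<close> be in \<open>\<B>(G,V)\<close> with \<open>max \<L>(a) \<le> k\<close>. A nonzero invariant \<open>f\<close> of multidegree \<open>a\<close>
  lies in \<open>F[V]\<^sup>G\<^sub>+\<close>, is homogeneous of degree \<open>|a|\<close>, and is not in \<open>deep_Inv (k + 1)\<close>, hence not in the
  \<open>(k + 1)\<close>-st power. So \<open>f\<close> witnesses \<open>|a| \<le> \<beta>\<^sub>k(G,V)\<close>.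
\<close>

section \<open>Substitution of polynomials\<close>

definition subst_monom :: "('x \<Rightarrow> ('y, 'f::field) mpoly) \<Rightarrow> ('x \<Rightarrow>\<^sub>0 nat) \<Rightarrow> ('y, 'f) mpoly" where
  "subst_monom \<sigma> m = (\<Prod>x\<in>Poly_Mapping.keys m. \<sigma> x ^ Poly_Mapping.lookup m x)"

text \<open>Exponents outside the support contribute the factor 1; this allows the supports of two monomials
  to be replaced by a common finite set.\<close>

lemma subst_monom_superset:
  assumes "finite A" "Poly_Mapping.keys m \<subseteq> A"
  shows "subst_monom \<sigma> m = (\<Prod>x\<in>A. \<sigma> x ^ Poly_Mapping.lookup m x)"
  unfolding subst_monom_def
  using assms by (intro prod.mono_neutral_left) (auto simp: in_keys_iff)

lemma subst_monom_add: "subst_monom \<sigma> (m + n) = subst_monom \<sigma> m * subst_monom \<sigma> n"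
proof -
  let ?A = "Poly_Mapping.keys m \<union> Poly_Mapping.keys n"
  have "subst_monom \<sigma> p = (\<Prod>x\<in>?A. \<sigma> x ^ Poly_Mapping.lookup p x)" if "p \<in> {m, n, m + n}" for p
    using that keys_add[of m n] by (intro subst_monom_superset) auto
  then show ?thesis
    by (simp add: lookup_add power_add prod.distrib)
qed

lemma subst_eq: "subst \<sigma> p =
    (\<Sum>m\<in>Poly_Mapping.keys p. Const (Poly_Mapping.lookup p m) * subst_monom \<sigma> m)"
  by (simp add: subst_def subst_monom_def)

lemma Const_simps:
  "Const 0 = 0" "Const 1 = 1" "Const (c + d) = Const c + Const d" "Const (c * d) = Const c * Const d"
  by (simp_all add: Const_def single_add mult_single)

lemma subst_add: "subst \<sigma> (p + q) = subst \<sigma> p + subst \<sigma> q"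
  unfolding subst_eq
  by (rule setsum_keys_plus_distrib) (simp_all add: Const_simps distrib_right)

lemma subst_zero [simp]: "subst \<sigma> 0 = 0"
  by (simp add: subst_def)

lemma subst_one [simp]: "subst \<sigma> 1 = 1"
  by (simp add: subst_eq Const_simps subst_monom_def)

lemma subst_sum: "subst \<sigma> (\<Sum>i\<in>I. p i) = (\<Sum>i\<in>I. subst \<sigma> (p i))"
  by (induction I rule: infinite_finite_induct) (simp_all add: subst_add)

lemma subst_uminus: "subst \<sigma> (- p) = - subst \<sigma> p"
  using subst_add[of \<sigma> p "- p"] by (simp add: eq_neg_iff_add_eq_0 add.commute)

lemma subst_single: "subst \<sigma> (Poly_Mapping.single m c) = Const c * subst_monom \<sigma> m"
  by (simp add: subst_eq Const_simps)

lemma sum_singles: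
  "(\<Sum>m\<in>Poly_Mapping.keys p. Poly_Mapping.single m (Poly_Mapping.lookup p m)) = p"
  by (rule poly_mapping_eqI)
    (auto simp: lookup_sum lookup_single when_def in_keys_iff sum.delta)

text \<open>Both sides are biadditive in \<open>p\<close> and \<open>q\<close>, and for monomials the law is \<open>subst_monom_add\<close>.\<close>

lemma subst_mult: "subst \<sigma> (p * q) = subst \<sigma> p * subst \<sigma> q"
proof -
  have single: "subst \<sigma> (Poly_Mapping.single m c * Poly_Mapping.single n d) =
      subst \<sigma> (Poly_Mapping.single m c) * subst \<sigma> (Poly_Mapping.single n d)" for m n c d
    by (simp add: mult_single subst_single Const_simps subst_monom_add mult_ac)
  have "subst \<sigma> (p * q) = subst \<sigma>
      ((\<Sum>m\<in>Poly_Mapping.keys p. Poly_Mapping.single m (Poly_Mapping.lookup p m)) *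
       (\<Sum>n\<in>Poly_Mapping.keys q. Poly_Mapping.single n (Poly_Mapping.lookup q n)))"
    by (simp only: sum_singles)
  also have "\<dots> = subst \<sigma>
       (\<Sum>m\<in>Poly_Mapping.keys p. Poly_Mapping.single m (Poly_Mapping.lookup p m)) *
      subst \<sigma> (\<Sum>n\<in>Poly_Mapping.keys q. Poly_Mapping.single n (Poly_Mapping.lookup q n))"
    by (simp only: sum_product subst_sum single)
  finally show ?thesis
    by (simp only: sum_singles)
qed

section \<open>Homogeneity with respect to an additive weight\<close>

text \<open>An additive weight of monomials defines a grading of the polynomial algebra. The weights used
  below are the single entries of the multidegree.\<close>

locale monomial_weight =
  fixes wt :: "('x \<Rightarrow>\<^sub>0 nat) \<Rightarrow> nat"
  assumes wt_add: "wt (m + n) = wt m + wt n"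
begin

definition homogeneous :: "nat \<Rightarrow> ('x, 'f::field) mpoly set" where
  "homogeneous d = {p. \<forall>m\<in>Poly_Mapping.keys p. wt m = d}"

lemma wt_zero [simp]: "wt 0 = 0"
  using wt_add[of 0 0] by simp

lemma wt_sum: "wt (\<Sum>i\<in>I. m i) = (\<Sum>i\<in>I. wt (m i))"
  by (induction I rule: infinite_finite_induct) (simp_all add: wt_add)

lemma homogeneous_mult: "p \<in> homogeneous d \<Longrightarrow> q \<in> homogeneous e \<Longrightarrow> p * q \<in> homogeneous (d + e)"
  using keys_mult[of p q] by (fastforce simp: homogeneous_def wt_add)

lemma homogeneous_one: "1 \<in> homogeneous 0"
  by (simp add: homogeneous_def)

lemma homogeneous_power: "p \<in> homogeneous d \<Longrightarrow> p ^ n \<in> homogeneous (n * d)"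
  by (induction n) (auto simp: homogeneous_one intro: homogeneous_mult)

lemma homogeneous_prod:
  "(\<And>i. i \<in> I \<Longrightarrow> p i \<in> homogeneous (d i)) \<Longrightarrow> (\<Prod>i\<in>I. p i) \<in> homogeneous (\<Sum>i\<in>I. d i)"
  by (induction I rule: infinite_finite_induct) (auto simp: homogeneous_one intro: homogeneous_mult)

lemma homogeneous_Const: "Const c \<in> homogeneous 0"
  by (simp add: homogeneous_def Const_def)

lemma wt_scale_single: "wt (Poly_Mapping.single x n) = n * wt (Poly_Mapping.single x 1)"
proof (induction n)
  case (Suc n)
  have "Poly_Mapping.single x (Suc n) = Poly_Mapping.single x n + Poly_Mapping.single x 1"
    by (simp flip: single_add)
  with Suc show ?case
    by (simp add: wt_add)
qed simp

lemma wt_eq: "wt m = (\<Sum>x\<in>Poly_Mapping.keys m. Poly_Mapping.lookup m x * wt (Poly_Mapping.single x 1))"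
proof -
  have "m = (\<Sum>x\<in>Poly_Mapping.keys m. Poly_Mapping.single x (Poly_Mapping.lookup m x))"
    by (simp only: sum_singles)
  then have "wt m = (\<Sum>x\<in>Poly_Mapping.keys m. wt (Poly_Mapping.single x (Poly_Mapping.lookup m x)))"
    by (metis wt_sum)
  then show ?thesis
    by (simp add: wt_scale_single[of _ "Poly_Mapping.lookup _ _"])
qed

text \<open>A substitution that sends each indeterminate to a form of the same weight preserves the weight of
  monomials, since an additive weight is determined by its values on indeterminates (\<open>wt_eq\<close>).\<close>

lemma subst_monom_homogeneous:
  assumes "\<And>x. \<sigma> x \<in> homogeneous (wt (Poly_Mapping.single x 1))"
  shows "subst_monom \<sigma> m \<in> homogeneous (wt m)"
  unfolding subst_monom_def wt_eq[of m]
  by (intro homogeneous_prod homogeneous_power assms)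

end

section \<open>Multidegrees and the action\<close>

context decomposed_G_module_with_basis
begin

definition multideg :: "('v \<Rightarrow>\<^sub>0 nat) \<Rightarrow> nat \<Rightarrow> nat" where
  "multideg m i = (if i \<in> {1..r} then \<Sum>b\<in>X i. Poly_Mapping.lookup m b else 0)"

lemma multideg_add: "multideg (m + n) i = multideg m i + multideg n i"
  by (simp add: multideg_def lookup_add sum.distrib)

lemma multideg_zero [simp]: "multideg 0 = (\<lambda>_. 0)"
  by (auto simp: multideg_def)

lemma finite_X: "i \<in> {1..r} \<Longrightarrow> finite (X i)"
  using finite_dimensional basis independent_span_bound by (metis subset_UNIV)

text \<open>A common vector \<open>b\<close> would have two decompositions, concentrated in the summands \<open>i\<close> and \<open>j\<close>; by
  directness \<open>b = 0\<close>, which is impossible in a linearly independent set.\<close>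

lemma X_disjoint:
  assumes "i \<in> {1..r}" "j \<in> {1..r}" "b \<in> X i" "b \<in> X j"
  shows "i = j"
proof (rule ccontr)
  assume "i \<noteq> j"
  let ?w = "\<lambda>k. restrict (\<lambda>l. if l = k then b else 0) {1..r}"
  have "?w k \<in> (\<Pi>\<^sub>E i\<in>{1..r}. W i) \<and> b = (\<Sum>i\<in>{1..r}. ?w k i)" if "k \<in> {i, j}" for k
  proof -
    have "k \<in> {1..r}" "b \<in> W k"
      using that assms basis span_base by blast+
    then show ?thesis
      using summand_subspace subspace_0 by auto
  qed
  then have "?w i = ?w j"
    using direct_sum[of b] by blast
  then have "?w i i = ?w j i"
    by (rule fun_cong)
  then have "b = 0"
    using assms(1) \<open>i \<noteq> j\<close> by (simp split: if_splits)
  then show False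
    using assms basis dependent_zero by blast
qed

lemma sum_multideg: "(\<Sum>i\<in>{1..r}. multideg m i) = (\<Sum>b\<in>B. Poly_Mapping.lookup m b)"
proof -
  have "(\<Sum>b\<in>B. Poly_Mapping.lookup m b) = (\<Sum>i\<in>{1..r}. \<Sum>b\<in>X i. Poly_Mapping.lookup m b)"
    unfolding B_def using finite_X X_disjoint by (intro sum.UNION_disjoint) auto
  then show ?thesis
    by (simp add: multideg_def)
qed

text \<open>The vector \<open>\<rho> g c\<close> stays in the summand spanned by \<open>X j\<close>, so its coordinates with respect to
  \<open>B\<close> are those with respect to \<open>X j\<close>.\<close>

lemma representation_X:
  assumes g: "g \<in> carrier G" and j: "j \<in> {1..r}" "c \<in> X j"
    and ne: "representation B (\<rho> g c) b \<noteq> 0"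
  shows "b \<in> X j"
proof -
  have "independent B"
    using ne by (auto simp: representation_def split: if_splits)
  moreover have "\<rho> g c \<in> span (X j)"
    using g j basis summand_stable span_base by metis
  moreover have "X j \<subseteq> B"
    using j by (auto simp: B_def)
  ultimately have "representation (X j) (\<rho> g c) b \<noteq> 0"
    using ne representation_extend by metis
  then show ?thesis
    by (rule representation_ne_zero)
qed

text \<open>The action preserves multidegrees: by \<open>representation_X\<close> it replaces the indeterminate of
  \<open>b \<in> X j\<close> by a linear form in the indeterminates of \<open>X j\<close>, hence by a form of the same weight
  for each entry of the multidegree.\<close>

lemma keys_act:
  assumes g: "g \<in> carrier G" and n: "n \<in> Poly_Mapping.keys (act g p)"
  obtains m where "m \<in> Poly_Mapping.keys p" "multideg n = multideg m"
proof -
  define \<sigma> where "\<sigma> b = linear_form (\<lambda>v. representation B (\<rho> (inv g) v) b)" for b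
  have \<sigma>: "multideg n i = multideg (Poly_Mapping.single b 1) i"
    if n: "n \<in> Poly_Mapping.keys (\<sigma> b)" for b n i
  proof -
    from n obtain c where c: "c \<in> B"
      and "n \<in> Poly_Mapping.keys (Const (representation B (\<rho> (inv g) c) b) * Var c)"
      unfolding \<sigma>_def linear_form_def using keys_sum by fastforce
    then have n: "n = Poly_Mapping.single c 1" and ne: "representation B (\<rho> (inv g) c) b \<noteq> 0"
      by (auto simp: Const_def Var_def mult_single split: if_splits)
    obtain j where j: "j \<in> {1..r}" "c \<in> X j"
      using c by (auto simp: B_def)
    have "b \<in> X j"
      using group.inv_closed[OF group_hom.axioms(1)[OF group_hom] g] j ne by (rule representation_X)
    \<comment> \<open>As the bases are disjoint, \<open>b\<close> and \<open>c\<close> are counted in the same entry \<open>j\<close> and in no other.\<close>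
    then have "c \<in> X i \<longleftrightarrow> b \<in> X i" if "i \<in> {1..r}"
      using j that X_disjoint by blast
    then show ?thesis
      using finite_X by (simp add: n multideg_def lookup_single when_def)
  qed
  from n obtain m where m: "m \<in> Poly_Mapping.keys p"
    and n: "n \<in> Poly_Mapping.keys (Const (Poly_Mapping.lookup p m) * subst_monom \<sigma> m)"
    unfolding act_def subst_eq \<sigma>_def[abs_def, symmetric] using keys_sum by fastforce
  have "multideg n i = multideg m i" for i
  proof -
    interpret monomial_weight "\<lambda>m. multideg m i"
      by unfold_locales (rule multideg_add)
    have "subst_monom \<sigma> m \<in> homogeneous (multideg m i)"
      using \<sigma> by (intro subst_monom_homogeneous) (simp add: homogeneous_def)
    from homogeneous_mult[OF homogeneous_Const this] n show ?thesis
      by (auto simp: homogeneous_def)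
  qed
  with m that show thesis
    by blast
qed

section \<open>The ring of invariants\<close>

lemma act_simps:
  "act g (p + q) = act g p + act g q" "act g (p * q) = act g p * act g q"
  "act g 0 = 0" "act g 1 = 1" "act g (- p) = - act g p"
  by (simp_all add: act_def subst_add subst_mult subst_uminus)

lemma FV_closed:
  "0 \<in> FV" "1 \<in> FV" "p \<in> FV \<Longrightarrow> - p \<in> FV"
  "p \<in> FV \<Longrightarrow> q \<in> FV \<Longrightarrow> p + q \<in> FV" "p \<in> FV \<Longrightarrow> q \<in> FV \<Longrightarrow> p * q \<in> FV"
proof -
  show "p + q \<in> FV" if "p \<in> FV" "q \<in> FV"
    using that keys_add[of p q] unfolding FV_def by blast
  show "p * q \<in> FV" if "p \<in> FV" "q \<in> FV"
  proof -
    have "Poly_Mapping.keys (m + n) \<subseteq> B"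
      if "m \<in> Poly_Mapping.keys p" "n \<in> Poly_Mapping.keys q" for m n
      using that \<open>p \<in> FV\<close> \<open>q \<in> FV\<close> keys_add[of m n] unfolding FV_def by blast
    then show ?thesis
      using keys_mult[of p q] unfolding FV_def by blast
  qed
qed (simp_all add: FV_def)

lemma Inv_closed:
  "0 \<in> Inv" "1 \<in> Inv" "p \<in> Inv \<Longrightarrow> - p \<in> Inv"
  "p \<in> Inv \<Longrightarrow> q \<in> Inv \<Longrightarrow> p + q \<in> Inv" "p \<in> Inv \<Longrightarrow> q \<in> Inv \<Longrightarrow> p * q \<in> Inv"
  by (simp_all add: Inv_def FV_closed act_simps)

lemma cring_Inv_ring: "cring Inv_ring"
proof (rule cringI)
  show "abelian_group Inv_ring"
  proof (rule abelian_groupI)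
    fix p assume "p \<in> carrier Inv_ring"
    then show "\<exists>q\<in>carrier Inv_ring. q \<oplus>\<^bsub>Inv_ring\<^esub> p = \<zero>\<^bsub>Inv_ring\<^esub>"
      by (intro bexI[of _ "- p"]) (simp_all add: Inv_ring_def Inv_closed)
  qed (simp_all add: Inv_ring_def Inv_closed ac_simps)
  show "comm_monoid Inv_ring"
    by (rule comm_monoidI) (simp_all add: Inv_ring_def Inv_closed ac_simps)
qed (simp add: Inv_ring_def distrib_right)

lemma BGV_vanishes: "a \<in> carrier BGV \<Longrightarrow> i \<notin> {1..r} \<Longrightarrow> a i = 0"
  by (simp add: BGV_def)

text \<open>Let \<open>h\<close> be the component of \<open>f\<close> of multidegree \<open>multideg m\<close>. It is nonzero, and it is invariant:
  since \<open>h + (f - h)\<close> is fixed by \<open>g\<close>, the difference \<open>act g h - h\<close> equals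
  \<open>(f - h) - act g (f - h)\<close>. By \<open>keys_act\<close> the former has only monomials of that multidegree and the
  latter has none of them, so both vanish.\<close>

lemma multideg_in_BGV:
  assumes f: "f \<in> Inv" and m: "m \<in> Poly_Mapping.keys f"
  shows "multideg m \<in> carrier BGV"
proof -
  define K where "K = {n \<in> Poly_Mapping.keys f. multideg n = multideg m}"
  define h where "h = (\<Sum>n\<in>K. Poly_Mapping.single n (Poly_Mapping.lookup f n))"
  have "finite K"
    by (simp add: K_def)
  then have lookup_h: "Poly_Mapping.lookup h n = (if n \<in> K then Poly_Mapping.lookup f n else 0)" for n
    by (simp add: h_def lookup_sum lookup_single when_def sum.delta)
  then have keys_h: "Poly_Mapping.keys h = K"
    by (auto simp: in_keys_iff K_def split: if_splits)
  have keys_rest: "Poly_Mapping.keys (f - h) \<subseteq> {n. multideg n \<noteq> multideg m}"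
    by (auto simp: in_keys_iff lookup_minus lookup_h K_def split: if_splits)
  have "act g h = h" if g: "g \<in> carrier G" for g
  proof -
    have "act g h + act g (f - h) = h + (f - h)"
      using f g by (simp add: Inv_def flip: act_simps)
    then have eq: "act g h - h = (f - h) - act g (f - h)"
      by (simp add: algebra_simps)
    have "multideg n = multideg m" if "n \<in> Poly_Mapping.keys (act g h)" for n
      using keys_act[OF g that] keys_h K_def by (metis (mono_tags, lifting) mem_Collect_eq)
    then have "Poly_Mapping.keys (act g h - h) \<subseteq> {n. multideg n = multideg m}"
      using keys_diff[of "act g h" h] keys_h unfolding K_def by blast
    moreover have "multideg n \<noteq> multideg m" if "n \<in> Poly_Mapping.keys (act g (f - h))" for n
      using keys_act[OF g that] keys_rest by (metis (mono_tags, lifting) mem_Collect_eq subsetD)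
    then have "Poly_Mapping.keys (act g h - h) \<subseteq> {n. multideg n \<noteq> multideg m}"
      unfolding eq using keys_rest keys_diff[of "f - h" "act g (f - h)"] by blast
    ultimately have "Poly_Mapping.keys (act g h - h) = {}"
      by blast
    then show ?thesis
      by simp
  qed
  moreover have "h \<in> FV"
    using f by (auto simp: Inv_def FV_def keys_h K_def)
  moreover have "\<forall>n\<in>K. \<forall>i\<in>{1..r}. (\<Sum>b\<in>X i. Poly_Mapping.lookup n b) = multideg m i"
  proof (intro ballI)
    fix n i assume "n \<in> K" "i \<in> {1..r}"
    then have "multideg n i = multideg m i"
      by (simp add: K_def)
    with \<open>i \<in> {1..r}\<close> show "(\<Sum>b\<in>X i. Poly_Mapping.lookup n b) = multideg m i"
      by (simp add: multideg_def)
  qed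
  ultimately have "h \<in> Inv \<inter> FV_multi (multideg m)"
    by (simp add: Inv_def FV_multi_def keys_h)
  moreover have "h \<noteq> 0"
    using m keys_h by (auto simp: K_def)
  ultimately show ?thesis
    by (auto simp: BGV_def multideg_def)
qed

section \<open>Factorizations in the monoid of multidegrees\<close>

lemma foldr_BGV:
  "foldr (\<otimes>\<^bsub>BGV\<^esub>) as \<one>\<^bsub>BGV\<^esub> i = (\<Sum>a\<leftarrow>as. a i)"
  by (induction as) (simp_all add: BGV_def)

lemma lengths_iff:
  "l \<in> lengths a \<longleftrightarrow> (\<exists>as. l = length as \<and> set as \<subseteq> carrier BGV \<and>
      (\<forall>x\<in>set as. irreducible BGV x) \<and> (\<forall>i. a i = (\<Sum>x\<leftarrow>as. x i)))"
  by (auto simp: lengths_def factors_def fun_eq_iff foldr_BGV)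

lemma lengths_zero: "0 \<in> lengths (\<lambda>_. 0)"
  by (simp add: lengths_iff)

lemma lengths_add:
  assumes "l \<in> lengths a" "l' \<in> lengths b"
  shows "l + l' \<in> lengths (\<lambda>i. a i + b i)"
proof -
  from assms obtain as bs where
    "l = length as" "set as \<subseteq> carrier BGV" "\<forall>x\<in>set as. irreducible BGV x" "\<And>i. a i = (\<Sum>x\<leftarrow>as. x i)"
    "l' = length bs" "set bs \<subseteq> carrier BGV" "\<forall>x\<in>set bs. irreducible BGV x" "\<And>i. b i = (\<Sum>x\<leftarrow>bs. x i)"
    unfolding lengths_iff by blast
  then show ?thesis
    unfolding lengths_iff by (intro exI[of _ "as @ bs"]) auto
qed

lemma zero_in_BGV: "(\<lambda>_. 0) \<in> carrier BGV"
  using multideg_in_BGV[OF Inv_closed(2)] by simp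

lemma Units_BGV: "Units BGV = {\<lambda>_. 0}"
  using zero_in_BGV by (fastforce simp: Units_def BGV_def fun_eq_iff)

lemma size_pos:
  assumes "a \<in> carrier BGV" "a \<noteq> (\<lambda>_. 0)"
  shows "0 < (\<Sum>i\<in>{1..r}. a i)"
proof -
  from assms(2) obtain i where "a i \<noteq> 0"
    by auto
  moreover from this have "i \<in> {1..r}"
    using assms(1) BGV_vanishes by metis
  ultimately have "0 < a i" "a i \<le> (\<Sum>i\<in>{1..r}. a i)"
    by (auto intro: member_le_sum)
  then show ?thesis
    by (rule less_le_trans)
qed

text \<open>Each atom contributes at least 1 to the size \<open>|a|\<close>. In particular \<open>lengths a\<close> is finite, so that
  its \<open>Max\<close> is meaningful.\<close>

lemma lengths_le_size:
  assumes "l \<in> lengths a"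
  shows "l \<le> (\<Sum>i\<in>{1..r}. a i)"
proof -
  obtain as where l: "l = length as" and as: "set as \<subseteq> carrier BGV" "\<forall>x\<in>set as. irreducible BGV x"
    and a: "\<And>i. a i = (\<Sum>x\<leftarrow>as. x i)"
    using assms unfolding lengths_iff by blast
  from as have "length as \<le> (\<Sum>i\<in>{1..r}. \<Sum>x\<leftarrow>as. x i)"
  proof (induction as)
    case (Cons x as)
    then have "0 < (\<Sum>i\<in>{1..r}. x i)"
      by (intro size_pos) (auto simp: irreducible_def Units_BGV)
    with Cons show ?case
      by (simp add: sum.distrib)
  qed simp
  then show ?thesis
    by (simp add: l a)
qed

text \<open>By induction on \<open>|a|\<close>: a nonzero element that is not an atom is a sum of two nonzero elements of
  the monoid, which are strictly smaller, and their factorizations concatenate.\<close>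

lemma lengths_pos:
  assumes "a \<in> carrier BGV" "a \<noteq> (\<lambda>_. 0)"
  shows "\<exists>l\<in>lengths a. 1 \<le> l"
  using assms
proof (induction "\<Sum>i\<in>{1..r}. a i" arbitrary: a rule: less_induct)
  case less
  show ?case
  proof (cases "irreducible BGV a")
    case True
    then have "1 \<in> lengths a"
      using less.prems unfolding lengths_iff by (intro exI[of _ "[a]"]) simp
    then show ?thesis
      by auto
  next
    case False
    then obtain b where b: "b \<in> carrier BGV" "properfactor BGV b a" "b \<noteq> (\<lambda>_. 0)"
      using less.prems by (auto simp: irreducible_def Units_BGV)
    then obtain c where c: "c \<in> carrier BGV" and a: "a = (\<lambda>i. b i + c i)"
      by (auto simp: properfactor_def factor_def BGV_def)
    have "c \<noteq> (\<lambda>_. 0)"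
    proof
      assume "c = (\<lambda>_. 0)"
      then have "b = a \<otimes>\<^bsub>BGV\<^esub> (\<lambda>_. 0)"
        by (simp add: a BGV_def)
      then show False
        using b(2) zero_in_BGV unfolding properfactor_def factor_def by blast
    qed
    then have "0 < (\<Sum>i\<in>{1..r}. b i)" "0 < (\<Sum>i\<in>{1..r}. c i)"
      using b c by (blast intro: size_pos)+
    then have "(\<Sum>i\<in>{1..r}. b i) < (\<Sum>i\<in>{1..r}. a i)" "(\<Sum>i\<in>{1..r}. c i) < (\<Sum>i\<in>{1..r}. a i)"
      by (simp_all add: a sum.distrib)
    then obtain l l' where "l \<in> lengths b" "1 \<le> l" "l' \<in> lengths c"
      using less.hyps b c \<open>c \<noteq> (\<lambda>_. 0)\<close> by blast
    then have "l + l' \<in> lengths a" "1 \<le> l + l'"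
      using lengths_add by (auto simp: a)
    then show ?thesis
      by blast
  qed
qed

section \<open>Powers of the ideal of positive degree\<close>

text \<open>The elements of degree at least \<open>l\<close> in the filtration of the invariants by factorization length.
  The inequality \<open>l \<le> l'\<close> instead of equality is what makes each member an ideal, as multiplication by
  an invariant can lengthen the factorizations.\<close>

definition deep_Inv :: "nat \<Rightarrow> ('v, 'f) mpoly set" where
  "deep_Inv l = {f \<in> Inv. \<forall>m\<in>Poly_Mapping.keys f. \<exists>l'\<in>lengths (multideg m). l \<le> l'}"

lemma deep_Inv_subset: "deep_Inv l \<subseteq> Inv"
  by (auto simp: deep_Inv_def)

lemma deep_Inv_0: "deep_Inv 0 = Inv"
proof -
  have "\<exists>l. l \<in> lengths a" if "a \<in> carrier BGV" for a
    using that lengths_pos lengths_zero by (cases "a = (\<lambda>_. 0)") blast+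
  then show ?thesis
    using multideg_in_BGV by (fastforce simp: deep_Inv_def)
qed

lemma deep_Inv_add: "f \<in> deep_Inv l \<Longrightarrow> h \<in> deep_Inv l \<Longrightarrow> f + h \<in> deep_Inv l"
  using keys_add[of f h] unfolding deep_Inv_def by (auto simp: Inv_closed)

text \<open>Every monomial of \<open>f * h\<close> is a product of monomials of \<open>f\<close> and \<open>h\<close>, and factorizations of their
  multidegrees concatenate.\<close>

lemma deep_Inv_mult:
  assumes "f \<in> deep_Inv l" "h \<in> deep_Inv l'"
  shows "f * h \<in> deep_Inv (l + l')"
proof -
  have "\<exists>s\<in>lengths (multideg p). l + l' \<le> s" if key: "p \<in> Poly_Mapping.keys (f * h)" for p
  proof -
    obtain m n where p: "p = m + n" and "m \<in> Poly_Mapping.keys f" "n \<in> Poly_Mapping.keys h"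
      using set_mp[OF keys_mult key] by blast
    then obtain s s' where "s \<in> lengths (multideg m)" "l \<le> s" "s' \<in> lengths (multideg n)" "l' \<le> s'"
      using assms unfolding deep_Inv_def by blast
    moreover have "multideg p = (\<lambda>i. multideg m i + multideg n i)"
      by (auto simp: p multideg_add)
    ultimately show ?thesis
      by (intro bexI[of _ "s + s'"]) (simp_all add: lengths_add)
  qed
  then show ?thesis
    using assms by (simp add: deep_Inv_def Inv_closed)
qed

lemma ideal_deep_Inv: "ideal (deep_Inv l) Inv_ring"
proof (rule idealI)
  interpret R: cring Inv_ring
    by (rule cring_Inv_ring)
  show "ring Inv_ring"
    by (rule R.ring_axioms)
  show "subgroup (deep_Inv l) (add_monoid Inv_ring)"
  proof (rule R.add.subgroupI)
    fix f assume f: "f \<in> deep_Inv l"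
    then have "f \<in> Inv"
      using deep_Inv_subset by blast
    then have "\<ominus>\<^bsub>Inv_ring\<^esub> f = - f"
      by (intro R.minus_equality) (simp_all add: Inv_ring_def Inv_closed)
    with f show "\<ominus>\<^bsub>Inv_ring\<^esub> f \<in> deep_Inv l"
      by (simp add: deep_Inv_def Inv_closed)
  next
    have "0 \<in> deep_Inv l"
      by (simp add: deep_Inv_def Inv_closed)
    then show "deep_Inv l \<noteq> {}"
      by blast
  qed (use deep_Inv_subset in \<open>auto simp: Inv_ring_def deep_Inv_add\<close>)
next
  fix f x assume "f \<in> deep_Inv l" "x \<in> carrier Inv_ring"
  then have "f * x \<in> deep_Inv l"
    using deep_Inv_mult[of f l x 0] by (simp add: deep_Inv_0 Inv_ring_def)
  then show "f \<otimes>\<^bsub>Inv_ring\<^esub> x \<in> deep_Inv l" "x \<otimes>\<^bsub>Inv_ring\<^esub> f \<in> deep_Inv l"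
    by (simp_all add: Inv_ring_def mult.commute)
qed

text \<open>The generators of \<open>Inv_plus\<close> have monomials of positive degree, hence of nonzero multidegree, and
  \<open>deep_Inv 1\<close> is an ideal that contains them.\<close>

lemma Inv_plus_subset_deep: "Inv_plus \<subseteq> deep_Inv 1"
proof -
  have "f \<in> deep_Inv 1" if "1 \<le> d" "f \<in> Inv" "f \<in> FV_deg d" for d f
  proof -
    have "\<exists>l\<in>lengths (multideg m). 1 \<le> l" if m: "m \<in> Poly_Mapping.keys f" for m
    proof (rule lengths_pos)
      have "(\<Sum>i\<in>{1..r}. multideg m i) = d"
        using \<open>f \<in> FV_deg d\<close> m unfolding sum_multideg FV_deg_def by blast
      with \<open>1 \<le> d\<close> show "multideg m \<noteq> (\<lambda>_. 0)"
        by auto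
    qed (rule multideg_in_BGV[OF \<open>f \<in> Inv\<close> m])
    with \<open>f \<in> Inv\<close> show ?thesis
      by (simp add: deep_Inv_def)
  qed
  then have "(\<Union>d\<in>{1..}. Inv \<inter> FV_deg d) \<subseteq> deep_Inv 1"
    by auto
  then show ?thesis
    unfolding Inv_plus_def genideal_def using ideal_deep_Inv by blast
qed

lemma Inv_plus_power_subset_deep: "Inv_plus [^]\<^bsub>ideals_set Inv_ring\<^esub> n \<subseteq> deep_Inv n"
proof (induction n)
  case 0
  then show ?case
    by (simp add: nat_pow_def ideals_set_def deep_Inv_0 Inv_ring_def)
next
  case (Suc n)
  have "f \<in> deep_Inv (n + 1)" if "f \<in> ideal_prod Inv_ring P Inv_plus" "P \<subseteq> deep_Inv n" for f P
    using that
  proof (induction rule: ideal_prod.induct)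
    case (prod i j)
    then show ?case
      using deep_Inv_mult[of i n j 1] Inv_plus_subset_deep by (auto simp: Inv_ring_def)
  next
    case (sum s1 s2)
    then show ?case
      by (simp add: Inv_ring_def deep_Inv_add)
  qed
  with Suc show ?case
    by (auto simp: nat_pow_def ideals_set_def)
qed

text \<open>A nonzero invariant of multidegree \<open>a\<close> outside the \<open>(k + 1)\<close>-st power of \<open>Inv_plus\<close> bounds
  \<open>beta k\<close> from below by \<open>|a|\<close>. The element \<open>a = 0\<close> has size 0 and is treated
  separately, since the nonzero constants lie outside \<open>Inv_plus\<close>.\<close>

lemma D_le_beta: "D k \<le> beta k"
  unfolding D_def
proof (rule SUP_least)
  fix a assume "a \<in> {a \<in> carrier BGV. Max (lengths a) \<le> k}"
  then have a: "a \<in> carrier BGV" and Max: "Max (lengths a) \<le> k"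
    by auto
  show "enat (\<Sum>i\<in>{1..r}. a i) \<le> beta k"
  proof (cases "a = (\<lambda>_. 0)")
    case True
    then show ?thesis
      by (simp flip: zero_enat_def)
  next
    case False
    have "0 \<in> Inv \<inter> FV_multi a"
      by (simp add: Inv_closed FV_multi_def FV_closed)
    then obtain f where f: "f \<in> Inv" "f \<in> FV_multi a" "f \<noteq> 0"
      using a by (auto simp: BGV_def)
    have deg: "multideg m = a" if "m \<in> Poly_Mapping.keys f" for m
      using f(2) that BGV_vanishes[OF a] by (auto simp: FV_multi_def multideg_def)
    have f_deg: "f \<in> FV_deg (\<Sum>i\<in>{1..r}. a i)"
      using f(2) deg by (auto simp: FV_deg_def FV_multi_def simp flip: sum_multideg)
    have "Inv_plus \<supseteq> (\<Union>d\<in>{1..}. Inv \<inter> FV_deg d)"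
      unfolding Inv_plus_def genideal_def by blast
    then have f_plus: "f \<in> Inv_plus"
      using f(1) f_deg size_pos[OF a False] by (fastforce simp: Suc_le_eq)
    have "f \<notin> deep_Inv (k + 1)"
    proof
      assume "f \<in> deep_Inv (k + 1)"
      moreover obtain m where "m \<in> Poly_Mapping.keys f"
        using f(3) by fastforce
      ultimately obtain l where l: "l \<in> lengths a" "k + 1 \<le> l"
        using deg unfolding deep_Inv_def by blast
      have "finite (lengths a)"
        using lengths_le_size unfolding finite_nat_set_iff_bounded_le by blast
      then have "l \<le> Max (lengths a)"
        using l by simp
      with l Max show False
        by simp
    qed
    then have "f \<notin> Inv_plus [^]\<^bsub>ideals_set Inv_ring\<^esub> (k + 1)"
      using Inv_plus_power_subset_deep by blast
    with f_plus f_deg show ?thesis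
      unfolding beta_def by (intro SUP_upper) blast
  qed
qed

end

theorem proposition4p12:
  fixes scale :: "'f::field \<Rightarrow> 'v::ab_group_add \<Rightarrow> 'v"
    and G :: "'g monoid"
    and \<rho> :: "'g \<Rightarrow> 'v \<Rightarrow> 'v"
    and r :: nat
    and W X :: "nat \<Rightarrow> 'v set"
    and k :: nat
  assumes "decomposed_G_module_with_basis scale G \<rho> r W X"
    and "\<not> CHAR('f) dvd order G"
    and "k \<ge> 1"
  shows "decomposed_G_module_with_basis.D scale G \<rho> r X k
       \<le> decomposed_G_module_with_basis.beta scale G \<rho> r X k"
  using assms(1) by (rule decomposed_G_module_with_basis.D_le_beta)

end
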